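(* Let $p\ge 1$ and $n\ge 0$ be integers and let $\mathcal G$ be the configuration graph of the Game of Cards with $p$ players and $n$ cards. Then $\mathcal G$ has at most one strongly connected component containing more than one configuration, and if such a component exists, it is exactly the set of dual configurations.
   Context: Game of Cards: $p$ players sit in a cycle; indices are taken modulo $p$, so the right neighbor of player $i$ is player $i+1$ and the right neighbor of player $p$ is player $1$. A configuration is a vector $a=(a_1,\dots,a_p)$ of nonnegative integers with $\sum_i a_i=n$, where $a_i$ is the number of cards of player $i$. A move at position $i$ is allowed in $a$ iff $a_i>a_{i+1}$ (with $a_{p+1}=a_1$); it produces the configuration in which $a_i$ is replaced by $a_i-1$ and $a_{i+1}$ by $a_{i+1}+1$. The graph $\mathcal G$ has the configurations as vertices and an arc $a\to b$ whenever $b$ is obtained from $a$ by one move. A configuration is called dual if it lies on a directed cycle of positive length in $\mathcal G$. *)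

theory Defs
  imports "Graph_Theory.Digraph_Component"
begin

text \<open>
  A configuration of \<open>p\<close> players is a list of length \<open>p\<close>. Players are numbered from \<open>0\<close> to
  \<open>p - 1\<close>, so the right neighbour of player \<open>i\<close> is \<open>Suc i mod p\<close>.
\<close>

definition configs :: "nat \<Rightarrow> nat \<Rightarrow> nat list set" where
  "configs p n = {a. length a = p \<and> sum_list a = n}"

definition right_nbr :: "nat \<Rightarrow> nat \<Rightarrow> nat" where
  "right_nbr p i = Suc i mod p"

definition allowed :: "nat list \<Rightarrow> nat \<Rightarrow> bool" where
  "allowed a i \<longleftrightarrow> i < length a \<and> a ! i > a ! right_nbr (length a) i"

text \<open>
  The update below is the intended one only if \<open>i\<close> and its right neighbour are distinct,
  which holds whenever the move is allowed.
\<close>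

definition move :: "nat list \<Rightarrow> nat \<Rightarrow> nat list" where
  "move a i = (let j = right_nbr (length a) i in a[i := a ! i - 1, j := a ! j + 1])"

text \<open>Different positions give different results, so arcs can be represented by pairs.\<close>

definition config_graph :: "nat \<Rightarrow> nat \<Rightarrow> (nat list, nat list \<times> nat list) pre_digraph" where
  "config_graph p n =
     \<lparr>verts = configs p n,
      arcs = {(a, b). a \<in> configs p n \<and> (\<exists>i. allowed a i \<and> b = move a i)},
      tail = fst, head = snd\<rparr>"

text \<open>
  Cycles are lists of arcs, nonempty by definition; the vertices on a cycle are the tails of
  its arcs.
\<close>

definition dual_configs :: "nat \<Rightarrow> nat \<Rightarrow> nat list set" where
  "dual_configs p n =
     {a. \<exists>c. pre_digraph.cycle (config_graph p n) c \<and> a \<in> tail (config_graph p n) ` set c}"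

lemma right_nbr_less: "allowed a i \<Longrightarrow> right_nbr (length a) i < length a"
  unfolding allowed_def right_nbr_def by (metis gr_implies_not0 gr0I mod_less_divisor)

lemma right_nbr_neq: "allowed a i \<Longrightarrow> right_nbr (length a) i \<noteq> i"
  unfolding allowed_def by auto

lemma move_in_configs:
  assumes "a \<in> configs p n" "allowed a i"
  shows "move a i \<in> configs p n"
proof -
  let ?j = "right_nbr (length a) i"
  have i: "i < length a" and pos: "0 < a ! i"
    using assms(2) by (auto simp: allowed_def)
  have le: "a ! i \<le> sum_list a"
    using i elem_le_sum_list by blast
  have "sum_list (move a i) = sum_list (a[i := a ! i - 1]) + (a ! ?j + 1) - a ! ?j"
    using right_nbr_less[OF assms(2)] right_nbr_neq[OF assms(2)]
    by (simp add: move_def Let_def sum_list_update)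
  also have "\<dots> = sum_list a"
    using i pos le by (simp add: sum_list_update)
  finally show ?thesis
    using assms(1) by (simp add: configs_def move_def Let_def)
qed

lemma move_neq:
  assumes "allowed a i"
  shows "move a i \<noteq> a"
proof
  assume "move a i = a"
  then have "move a i ! i = a ! i" by simp
  moreover have "move a i ! i = a ! i - 1"
    using assms right_nbr_neq[OF assms] by (simp add: move_def Let_def allowed_def)
  ultimately show False using assms unfolding allowed_def by linarith
qed

lemma finite_configs: "finite (configs p n)"
proof (rule finite_subset)
  show "configs p n \<subseteq> {a. set a \<subseteq> {..n} \<and> length a = p}"
    by (auto simp: configs_def intro: member_le_sum_list)
  show "finite {a. set a \<subseteq> {..n} \<and> length a = p}"
    by (rule finite_lists_length_eq) simp
qed

lemma digraph_config_graph: "digraph (config_graph p n)"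
proof
  have "arcs (config_graph p n) \<subseteq> configs p n \<times> configs p n"
    by (auto simp: config_graph_def move_in_configs)
  then show "finite (arcs (config_graph p n))"
    by (rule finite_subset) (simp add: finite_configs)
qed (auto simp: config_graph_def move_in_configs finite_configs arc_to_ends_def
       dest: move_neq[THEN not_sym])

end

theory Submission
  imports Defs
begin

text \<open>
  A move never increases the sum of squares, and preserves it only if it swaps two values
  differing by one. Such a swap strictly decreases the energy
  \<open>\<Sum>x y. max 0 (a\<^sub>x - a\<^sub>y - 1) \<cdot> d(x,y)\<close>, with \<open>d(x,y)\<close> the number of
  steps to the right from \<open>x\<close> to \<open>y\<close>, as soon as two values differ by at least two: for every
  \<open>k\<close>, players holding at least \<open>k + 1\<close> cards and players holding at most \<open>k - 1\<close> cards
  approach each other but can never pass. So all values on a cycle lie in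
  \<open>{k, k + 1}\<close> with \<open>k = n div p\<close>. Conversely, among such configurations any \<open>k + 1\<close> and any \<open>k\<close>
  can be exchanged by a sequence of moves, so they are pairwise mutually reachable.
\<close>

section \<open>Cycles and strong components\<close>

text \<open>\<open>cycle\<close> forbids repeated vertices, so a closed walk need not be one: its
  first arc is kept and the rest is shortened to a path. Conversely, a cycle is cut open at the arc
  leaving \<open>a\<close>.\<close>

lemma (in wf_digraph) on_cycle_iff_reachable1:
  "(\<exists>c. cycle c \<and> a \<in> tail G ` set c) \<longleftrightarrow> a \<rightarrow>\<^sup>+ a"
proof
  assume "\<exists>c. cycle c \<and> a \<in> tail G ` set c"
  then obtain c u e where c: "awalk u c u" and e: "e \<in> set c" "a = tail G e"
    unfolding cycle_def by auto
  obtain q r where "c = q @ e # r"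
    using e(1) split_list by metis
  with c e(2) have q: "awalk u q a" and r: "awalk a (e # r) u"
    by (auto simp: awalk_append_iff awalk_Cons_iff)
  from r have "a \<rightarrow>\<^sup>+ u"
    unfolding reachable1_awalk by auto
  also have "u \<rightarrow>\<^sup>* a"
    using q unfolding reachable_awalk by blast
  finally show "a \<rightarrow>\<^sup>+ a" .
next
  assume "a \<rightarrow>\<^sup>+ a"
  then obtain p where "awalk a p a" "p \<noteq> []"
    unfolding reachable1_awalk by blast
  then obtain e p' where e: "e \<in> arcs G" "tail G e = a" and "awalk (head G e) p' a"
    by (cases p) (auto simp: awalk_Cons_iff)
  then have "apath (head G e) (awalk_to_apath p') a"
    by (intro apath_awalk_to_apath)
  with e have "awalk a (e # awalk_to_apath p') a"
      "distinct (tl (awalk_verts a (e # awalk_to_apath p')))"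
    by (auto simp: apath_def awalk_Cons_iff)
  then have "cycle (e # awalk_to_apath p')"
    unfolding cycle_def by blast
  with e(2) show "\<exists>c. cycle c \<and> a \<in> tail G ` set c"
    by force
qed

text \<open>Two distinct vertices of a component yield a closed walk through each, and maximality
  absorbs every vertex mutually reachable with one of them. What remains to be shown about the game
  is \<open>mutual\<close>.\<close>

lemma (in wf_digraph) nontrivial_scc_eq:
  assumes mutual: "\<And>u v. u \<rightarrow>\<^sup>+ u \<Longrightarrow> v \<rightarrow>\<^sup>+ v \<Longrightarrow> u \<rightarrow>\<^sup>* v"
    and S: "S \<in> sccs_verts" "card S > 1"
  shows "S = {v. v \<rightarrow>\<^sup>+ v}"
proof
  show sub: "S \<subseteq> {v. v \<rightarrow>\<^sup>+ v}"
  proof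
    fix u assume u: "u \<in> S"
    have "\<not> S \<subseteq> {u}"
      using S(2) card_mono[of "{u}" S] by auto
    then obtain v where "v \<in> S" "v \<noteq> u"
      by blast
    with u S(1) have "u \<rightarrow>\<^sup>+ v" "v \<rightarrow>\<^sup>* u"
      by (auto simp: sccs_verts_def)
    then show "u \<in> {v. v \<rightarrow>\<^sup>+ v}"
      using reachable1_reachable_trans by blast
  qed
  obtain u where u: "u \<in> S"
    using S(1) by (auto simp: sccs_verts_def)
  with sub have "u \<rightarrow>\<^sup>+ u"
    by blast
  then show "{v. v \<rightarrow>\<^sup>+ v} \<subseteq> S"
    using mutual S(1) u unfolding sccs_verts_def by blast
qed

section \<open>Closed walks pass only through balanced configurations\<close>

text \<open>The pairwise form avoids naming the level \<open>k\<close>;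
  \<open>balanced_values\<close> recovers it.\<close>

definition balanced :: "nat list \<Rightarrow> bool" where
  "balanced a \<longleftrightarrow> (\<forall>x\<in>set a. \<forall>y\<in>set a. x \<le> Suc y)"

definition sum_squares :: "nat list \<Rightarrow> nat" where
  "sum_squares a = (\<Sum>x\<leftarrow>a. x * x)"

text \<open>The number of steps to the right from \<open>x\<close> to \<open>y\<close>, except that it is \<open>p\<close> if \<open>x = y\<close>.\<close>

definition cdist :: "nat \<Rightarrow> nat \<Rightarrow> nat \<Rightarrow> nat" where
  "cdist p x y = (if x < y then y - x else y + p - x)"

text \<open>Truncated subtraction restricts the sum to the pairs with \<open>a ! x \<ge> a ! y + 2\<close>.\<close>

definition energy :: "nat list \<Rightarrow> nat" where
  "energy a = (\<Sum>x<length a. \<Sum>y<length a. (a ! x - a ! y - 1) * cdist (length a) x y)"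

lemma sum_squares_update:
  "i < length a \<Longrightarrow> sum_squares (a[i := v]) + a ! i * a ! i = sum_squares a + v * v"
  unfolding sum_squares_def
  by (induction a arbitrary: i) (auto split: nat.splits)

lemma right_nbr_cases:
  "i < p \<Longrightarrow> right_nbr p i = (if Suc i = p then 0 else Suc i)"
  by (auto simp: right_nbr_def)

lemma cdist_left_nbr:
  assumes "i < p" "y < p" "y \<noteq> i" "y \<noteq> right_nbr p i"
  shows "cdist p i y = Suc (cdist p (right_nbr p i) y)"
  using assms by (auto simp: cdist_def right_nbr_cases)

lemma cdist_right_nbr:
  assumes "i < p" "x < p" "x \<noteq> i" "x \<noteq> right_nbr p i"
  shows "cdist p x (right_nbr p i) = Suc (cdist p x i)"
  using assms by (auto simp: cdist_def right_nbr_cases)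

lemma double_sum_split_two:
  fixes F :: "'a \<Rightarrow> 'a \<Rightarrow> nat"
  assumes "finite A" "i \<in> A" "j \<in> A" "i \<noteq> j"
  shows "(\<Sum>x\<in>A. \<Sum>y\<in>A. F x y) =
    F i i + F i j + F j i + F j j
    + (\<Sum>y\<in>A - {i, j}. F i y + F j y) + (\<Sum>x\<in>A - {i, j}. F x i + F x j)
    + (\<Sum>x\<in>A - {i, j}. \<Sum>y\<in>A - {i, j}. F x y)"
proof -
  have split: "sum g A = g i + (g j + sum g (A - {i, j}))" for g :: "'a \<Rightarrow> nat"
  proof -
    have "A - {i} - {j} = A - {i, j}" by auto
    then show ?thesis
      using assms sum.remove[of A i g] sum.remove[of "A - {i}" j g] by auto
  qed
  show ?thesis
    by (simp add: split sum.distrib)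
qed

text \<open>The swap brings the value \<open>Suc k\<close> one step closer to each player below
  \<open>k\<close>, and brings each player above \<open>Suc k\<close> one step closer to the value
  \<open>k\<close>. Each such player lowers the energy by exactly one, and nothing else
  changes.\<close>

lemma energy_swap_less:
  assumes i: "i < length a" and j: "j = right_nbr (length a) i"
    and ai: "a ! i = Suc k" and aj: "a ! j = k" and unb: "\<not> balanced a"
  shows "energy (a[i := k, j := Suc k]) < energy a"
proof -
  define p where "p = length a"
  define b where "b = a[i := k, j := Suc k]"
  define S where "S = {..<p} - {i, j}"
  have ij: "i \<noteq> j" using ai aj by auto
  have jp: "j < p" using i j by (auto simp: p_def right_nbr_cases)
  have ip: "i < p" using i p_def by simp
  have bi: "b ! i = k" and bj: "b ! j = Suc k"
    and bS: "\<And>x. x \<in> S \<Longrightarrow> b ! x = a ! x"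
    using ip jp ij by (auto simp: b_def S_def p_def)
  have len: "length b = p" by (simp add: b_def p_def)
  \<comment> \<open>\<open>row\<close> collects the pairs leading from \<open>i\<close> or
    \<open>j\<close> to an outside player, \<open>col\<close> those leading from an outside player
    to \<open>i\<close> or \<open>j\<close>.\<close>
  define row where "row c y = (c ! i - c ! y - 1) * cdist p i y + (c ! j - c ! y - 1) * cdist p j y"
    for c :: "nat list" and y
  define col where "col c x = (c ! x - c ! i - 1) * cdist p x i + (c ! x - c ! j - 1) * cdist p x j"
    for c :: "nat list" and x
  define rest where
    "rest = (\<Sum>x\<in>S. \<Sum>y\<in>S. (a ! x - a ! y - 1) * cdist p x y)"
  \<comment> \<open>The four terms with both indices in \<open>{i, j}\<close> vanish, since these
    values differ by at most one; likewise for \<open>b\<close> below.\<close>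
  have ea: "energy a = sum (row a) S + sum (col a) S + rest"
    unfolding energy_def p_def[symmetric]
    using double_sum_split_two[of "{..<p}" i j "\<lambda>x y. (a ! x - a ! y - 1) * cdist p x y"]
      ip jp ij ai aj by (simp add: row_def[abs_def] col_def[abs_def] rest_def S_def)
  have rest_b: "rest = (\<Sum>x\<in>S. \<Sum>y\<in>S. (b ! x - b ! y - 1) * cdist p x y)"
    unfolding rest_def by (intro sum.cong refl) (simp add: bS)
  have eb: "energy b = sum (row b) S + sum (col b) S + rest"
    unfolding energy_def len rest_b
    using double_sum_split_two[of "{..<p}" i j "\<lambda>x y. (b ! x - b ! y - 1) * cdist p x y"]
      ip jp ij bi bj by (simp add: row_def[abs_def] col_def[abs_def] S_def)
  have row: "row b y + (if a ! y < k then 1 else 0) = row a y" if y: "y \<in> S" for y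
  proof -
    have dist: "cdist p i y = Suc (cdist p j y)"
      using cdist_left_nbr[of i p y] ip y j by (auto simp: S_def p_def)
    \<comment> \<open>If \<open>a ! y \<ge> k\<close>, truncation makes both rows zero; otherwise
      writing \<open>k\<close> as \<open>Suc (a ! y + d)\<close> removes the truncation. Columns are
      treated alike.\<close>
    show ?thesis
    proof (cases "a ! y < k")
      case True
      then obtain d where "k = Suc (a ! y + d)"
        using less_iff_Suc_add by auto
      with dist show ?thesis
        by (simp add: row_def bi bj ai aj bS[OF y] algebra_simps)
    qed (simp add: row_def bi bj ai aj bS[OF y])
  qed
  have col: "col b x + (if a ! x > Suc k then 1 else 0) = col a x" if x: "x \<in> S" for x
  proof -
    have dist: "cdist p x j = Suc (cdist p x i)"
      using cdist_right_nbr[of i p x] ip x j by (auto simp: S_def p_def)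
    show ?thesis
    proof (cases "a ! x > Suc k")
      case True
      then obtain d where "a ! x = Suc (Suc k + d)"
        using less_iff_Suc_add by blast
      with dist show ?thesis
        by (simp add: col_def bi bj ai aj bS[OF x] algebra_simps)
    qed (simp add: col_def bi bj ai aj bS[OF x])
  qed
  have row_le: "row b y \<le> row a y" and col_le: "col b y \<le> col a y" if "y \<in> S" for y
    using row[OF that] col[OF that] by linarith+
  have fin: "finite S" by (simp add: S_def)
  obtain x y where xy: "x < p" "y < p" "a ! x > Suc (a ! y)"
    using unb by (auto simp: balanced_def in_set_conv_nth p_def not_le)
  \<comment> \<open>Values at least two apart cannot both lie in \<open>{k, Suc k}\<close>: either
    the smaller is below \<open>k\<close> or the larger is above \<open>Suc k\<close>. That player
    differs from \<open>i\<close> and \<open>j\<close> and gives the strict drop.\<close>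
  have "sum (row b) S + sum (col b) S < sum (row a) S + sum (col a) S"
  proof (cases "a ! y < k")
    case True
    then have "y \<in> S" using xy ai aj by (auto simp: S_def)
    moreover from this True have "row b y < row a y" using row[of y] by simp
    ultimately have "sum (row b) S < sum (row a) S"
      using row_le by (intro sum_strict_mono_ex1[OF fin]) auto
    then show ?thesis
      using sum_mono[of S "col b" "col a", OF col_le] by linarith
  next
    case False
    then have "a ! x > Suc k" using xy by simp
    then have "x \<in> S" using xy ai aj by (auto simp: S_def)
    moreover from this \<open>a ! x > Suc k\<close> have "col b x < col a x" using col[of x] by simp
    ultimately have "sum (col b) S < sum (col a) S"
      using col_le by (intro sum_strict_mono_ex1[OF fin]) auto
    then show ?thesis
      using sum_mono[of S "row b" "row a", OF row_le] by linarith
  qed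
  then show ?thesis
    by (simp add: ea eb flip: b_def)
qed

text \<open>Expanding the squares shows a loss of twice the gap minus two, so only a gap of one
  preserves the sum.\<close>

lemma sum_squares_move:
  assumes "allowed a i"
  defines "j \<equiv> right_nbr (length a) i"
  shows "sum_squares (move a i) + 2 * (a ! i - a ! j) = sum_squares a + 2"
proof -
  have "i < length a" "j < length a" "j \<noteq> i" "a ! j < a ! i"
    using assms right_nbr_less right_nbr_neq by (auto simp: allowed_def)
  then obtain d where d: "a ! i = Suc (a ! j + d)"
    using less_iff_Suc_add by auto
  have "sum_squares (a[i := a ! i - 1]) + a ! i * a ! i
      = sum_squares a + (a ! i - 1) * (a ! i - 1)"
    using \<open>i < length a\<close> by (rule sum_squares_update)
  moreover have "sum_squares (move a i) + a ! j * a ! j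
      = sum_squares (a[i := a ! i - 1]) + (a ! j + 1) * (a ! j + 1)"
    using sum_squares_update[of j "a[i := a ! i - 1]" "a ! j + 1"] \<open>j < length a\<close> \<open>j \<noteq> i\<close>
    by (simp add: move_def j_def Let_def)
  ultimately show ?thesis
    using d by (simp add: algebra_simps)
qed

lemma move_cases:
  assumes "allowed a i"
  shows "sum_squares (move a i) < sum_squares a \<or>
    sum_squares (move a i) = sum_squares a \<and>
      a ! i = Suc (a ! right_nbr (length a) i) \<and>
      move a i = a[i := a ! right_nbr (length a) i, right_nbr (length a) i := a ! i]"
proof (cases "a ! i = Suc (a ! right_nbr (length a) i)")
  case True
  then show ?thesis
    using sum_squares_move[OF assms] by (simp add: move_def Let_def)
next
  case False
  then have "2 * (a ! i - a ! right_nbr (length a) i) > 2"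
    using assms unfolding allowed_def by arith
  then show ?thesis
    using sum_squares_move[OF assms] by linarith
qed

lemma move_lex_less:
  assumes "allowed a i" "\<not> balanced a"
  shows "(move a i, a) \<in> measures [sum_squares, energy]"
  using move_cases[OF assms(1)] energy_swap_less[of i a] assms
  by (auto simp: allowed_def)

text \<open>An allowed move then has gap one and swaps two entries, so the set of values is
  unchanged.\<close>

lemma balanced_move:
  assumes "allowed a i" "balanced a"
  shows "balanced (move a i)"
proof -
  define j where "j = right_nbr (length a) i"
  have ij: "i < length a" "j < length a" "a ! j < a ! i"
    using assms(1) right_nbr_less by (auto simp: j_def allowed_def)
  then have "a ! i \<le> Suc (a ! j)"
    using assms(2) by (simp add: balanced_def)
  with ij(3) have "a ! i = Suc (a ! j)" by simp
  then have "move a i = a[i := a ! j, j := a ! i]"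
    by (simp add: move_def Let_def j_def)
  then have "set (move a i) = set a"
    using ij by simp
  then show ?thesis
    using assms(2) by (simp add: balanced_def)
qed

lemma arcs_ends_config_graph:
  "arcs_ends (config_graph p n) = {(a, move a i) | a i. a \<in> configs p n \<and> allowed a i}"
  by (auto simp: arcs_ends_def arc_to_ends_def config_graph_def)

text \<open>Since moves preserve balance, an unbalanced end forces every earlier configuration to be
  unbalanced, so the measure drops at each step.\<close>

lemma reachable1_unbalanced:
  assumes "a \<rightarrow>\<^sup>+\<^bsub>config_graph p n\<^esub> b" "\<not> balanced b"
  shows "\<not> balanced a \<and> (b, a) \<in> measures [sum_squares, energy]"
  using assms
proof (induction rule: converse_trancl_induct)
  case (base a)
  then show ?case
    using balanced_move move_lex_less by (auto simp: arcs_ends_config_graph)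
next
  case (step a c)
  then have "\<not> balanced c" "(b, c) \<in> measures [sum_squares, energy]"
    by auto
  moreover have "\<not> balanced a" "(c, a) \<in> measures [sum_squares, energy]"
    using step.hyps(1) \<open>\<not> balanced c\<close> balanced_move move_lex_less
    by (auto simp: arcs_ends_config_graph)
  ultimately show ?case
    by auto
qed

lemma balanced_if_reachable1_self:
  "a \<rightarrow>\<^sup>+\<^bsub>config_graph p n\<^esub> a \<Longrightarrow> balanced a"
  using reachable1_unbalanced by fastforce

text \<open>The minimum \<open>m\<close> is attained and all entries are \<open>m\<close> or
  \<open>Suc m\<close>, hence \<open>p * m \<le> n < p * Suc m\<close>.\<close>

lemma balanced_values:
  assumes "a \<in> configs p n" "balanced a" "p \<ge> 1"
  shows "set a \<subseteq> {n div p, Suc (n div p)}"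
proof -
  have len: "length a = p" and n: "n = (\<Sum>i<p. a ! i)"
    using assms(1) by (auto simp: configs_def sum_list_sum_nth atLeast0LessThan)
  define m where "m = Min (set a)"
  have "a \<noteq> []" using len assms(3) by auto
  then have m: "m \<in> set a" "\<And>x. x \<in> set a \<Longrightarrow> m \<le> x"
    by (simp_all add: m_def)
  then have vals: "set a \<subseteq> {m, Suc m}"
    using assms(2) by (force simp: balanced_def)
  have "(\<Sum>i<p. m) \<le> n"
    unfolding n using m(2) len by (intro sum_mono) auto
  moreover obtain i where "i < p" "a ! i = m"
    using m(1) len by (auto simp: in_set_conv_nth)
  then have "n < (\<Sum>i<p. Suc m)"
    unfolding n using vals len by (intro sum_strict_mono_ex1) (auto dest: nth_mem)
  ultimately have "n div p = m"
    by (intro div_nat_eqI) (simp_all add: mult.commute)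
  with vals show ?thesis by simp
qed

section \<open>Balanced configurations reach each other\<close>

text \<open>Induction on the distance, by the value at the right neighbour \<open>i'\<close> of
  \<open>i\<close>. If it is \<open>k\<close>, move from \<open>i\<close> first and then exchange
  \<open>i'\<close> with the target; if it is \<open>Suc k\<close>, that exchange comes first and
  makes room for the move from \<open>i\<close>.\<close>

lemma reachable_exchange:
  assumes "a \<in> configs p n" "set a \<subseteq> {k, Suc k}" "i < p" "0 < d" "d < p"
    and "a ! i = Suc k" "a ! ((i + d) mod p) = k"
  shows "a \<rightarrow>\<^sup>*\<^bsub>config_graph p n\<^esub> a[i := k, (i + d) mod p := Suc k]"
  using assms
proof (induction d arbitrary: a i)
  case (Suc d)
  interpret digraph "config_graph p n" by (rule digraph_config_graph)
  have len: "length a = p" using Suc.prems by (simp add: configs_def)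
  define i' where "i' = right_nbr p i"
  define j where "j = (i + Suc d) mod p"
  have i': "i' < p" "i' \<noteq> i" and j: "j < p"
    using Suc.prems by (auto simp: i'_def j_def right_nbr_cases)
  have ji': "j = (i' + d) mod p"
    by (simp add: i'_def j_def right_nbr_def mod_add_left_eq)
  have ai: "a ! i = Suc k" and aj: "a ! j = k"
    using Suc.prems by (auto simp: j_def)
  then have ij: "i \<noteq> j" by auto
  have one: "c \<rightarrow>\<^sup>*\<^bsub>config_graph p n\<^esub> c[i := k, i' := Suc k]"
    if "c \<in> configs p n" "c ! i = Suc k" "c ! i' = k" for c
  proof -
    have "allowed c i" "move c i = c[i := k, i' := Suc k]"
      using that Suc.prems(3) by (auto simp: configs_def allowed_def move_def Let_def i'_def)
    with that(1) have "(c, c[i := k, i' := Suc k]) \<in> arcs_ends (config_graph p n)"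
      unfolding arcs_ends_config_graph by force
    then show ?thesis by auto
  qed
  have in_configs: "c \<in> configs p n" if "b \<rightarrow>\<^sup>*\<^bsub>config_graph p n\<^esub> c" for b c
    using reachable_in_verts[OF that] by (simp add: config_graph_def)
  show ?case
  proof (cases "d = 0")
    case True
    with ji' i' have "j = i'" by simp
    then show ?thesis
      using one[OF Suc.prems(1) ai] aj unfolding j_def[symmetric] by simp
  next
    case False
    then have "d > 0" "d < p" using Suc.prems by auto
    have "i' \<noteq> j"
    proof
      assume "i' = j"
      then have "(i' + d) mod p = i'" using ji' by simp
      with i'(1) \<open>d > 0\<close> \<open>d < p\<close> show False
        by (cases "i' + d < p") (simp_all add: le_mod_geq)
    qed
    have "a ! i' \<in> {k, Suc k}"
      using Suc.prems(2) i' len nth_mem by blast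
    then consider "a ! i' = k" | "a ! i' = Suc k" by blast
    then show ?thesis
    proof cases
      case 1
      define b where "b = a[i := k, i' := Suc k]"
      have ab: "a \<rightarrow>\<^sup>*\<^bsub>config_graph p n\<^esub> b"
        unfolding b_def using Suc.prems(1) ai 1 by (rule one)
      have "set b \<subseteq> {k, Suc k}"
        using Suc.prems(2) unfolding b_def by (auto dest!: set_update_subset_insert[THEN subsetD])
      moreover have "b ! i' = Suc k" "b ! j = k"
        using i' j len ij \<open>i' \<noteq> j\<close> aj by (auto simp: b_def)
      ultimately have "b \<rightarrow>\<^sup>*\<^bsub>config_graph p n\<^esub> b[i' := k, j := Suc k]"
        using Suc.IH[of b i'] in_configs[OF ab] i' \<open>d > 0\<close> \<open>d < p\<close> by (simp add: ji')
      moreover have "b[i' := k, j := Suc k] = a[i := k, j := Suc k]"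
      proof (rule nth_equalityI)
        fix x assume "x < length (b[i' := k, j := Suc k])"
        then show "b[i' := k, j := Suc k] ! x = a[i := k, j := Suc k] ! x"
          using 1 i' j ij \<open>i' \<noteq> j\<close> len by (auto simp: b_def nth_list_update)
      qed (simp add: b_def)
      ultimately show ?thesis
        using ab reachable_trans unfolding j_def by metis
    next
      case 2
      define b where "b = a[i' := k, j := Suc k]"
      have ab: "a \<rightarrow>\<^sup>*\<^bsub>config_graph p n\<^esub> b"
        unfolding b_def ji'
        using Suc.IH[of a i'] Suc.prems(1,2) i' \<open>d > 0\<close> \<open>d < p\<close> 2 aj by (simp add: ji')
      have "b ! i = Suc k" "b ! i' = k"
        using i' j len ij \<open>i' \<noteq> j\<close> ai Suc.prems(3) by (auto simp: b_def)
      then have "b \<rightarrow>\<^sup>*\<^bsub>config_graph p n\<^esub> b[i := k, i' := Suc k]"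
        using in_configs[OF ab] by (intro one)
      moreover have "b[i := k, i' := Suc k] = a[i := k, j := Suc k]"
      proof (rule nth_equalityI)
        fix x assume "x < length (b[i := k, i' := Suc k])"
        then show "b[i := k, i' := Suc k] ! x = a[i := k, j := Suc k] ! x"
          using 2 Suc.prems(3) i' j ij \<open>i' \<noteq> j\<close> len by (auto simp: b_def nth_list_update)
      qed (simp add: b_def)
      ultimately show ?thesis
        using ab reachable_trans unfolding j_def by metis
    qed
  qed
qed simp

text \<open>Equal totals force a surplus at some \<open>i\<close> and a deficit at some
  \<open>j\<close>; exchanging the two corrects both positions, so the number of disagreements with
  \<open>b\<close> falls.\<close>

lemma balanced_reachable:
  assumes "a \<in> configs p n" "b \<in> configs p n" "set a \<subseteq> {k, Suc k}" "set b \<subseteq> {k, Suc k}"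
  shows "a \<rightarrow>\<^sup>*\<^bsub>config_graph p n\<^esub> b"
  using assms(1,3)
proof (induction "card {x. x < p \<and> a ! x \<noteq> b ! x}" arbitrary: a rule: less_induct)
  case less
  interpret digraph "config_graph p n" by (rule digraph_config_graph)
  have len: "length a = p" "length b = p"
    using less.prems(1) assms(2) by (auto simp: configs_def)
  have sums: "(\<Sum>x<p. a ! x) = n" "(\<Sum>x<p. b ! x) = n"
    using less.prems(1) assms(2) by (auto simp: configs_def sum_list_sum_nth atLeast0LessThan)
  have vals: "a ! x \<in> {k, Suc k}" "b ! x \<in> {k, Suc k}" if "x < p" for x
    using that len less.prems(2)[THEN subsetD, of "a ! x"] assms(4)[THEN subsetD, of "b ! x"]
    by auto
  show ?case
  proof (cases "a = b")
    case True
    moreover have "a \<in> verts (config_graph p n)"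
      using less.prems(1) by (simp add: config_graph_def)
    ultimately show ?thesis
      by simp
  next
    case False
    then obtain z where z: "z < p" "a ! z \<noteq> b ! z"
      using len by (metis nth_equalityI)
    have "\<not> (\<forall>x<p. a ! x \<le> b ! x)"
      using z sums sum_strict_mono_ex1[of "{..<p}" "(!) a" "(!) b"] by force
    then obtain i where i: "i < p" "a ! i = Suc k" "b ! i = k"
      using vals by (metis empty_iff insert_iff le_refl le_Suc_eq)
    have "\<not> (\<forall>x<p. b ! x \<le> a ! x)"
      using z sums sum_strict_mono_ex1[of "{..<p}" "(!) b" "(!) a"] by force
    then obtain j where j: "j < p" "a ! j = k" "b ! j = Suc k"
      using vals by (metis empty_iff insert_iff le_refl le_Suc_eq)
    have "i \<noteq> j" using i j by auto
    \<comment> \<open>This is \<open>cdist p i j\<close>, the number of steps to the right from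
      \<open>i\<close> to \<open>j\<close>.\<close>
    define d where "d = (if i < j then j - i else j + p - i)"
    have d: "0 < d" "d < p" "(i + d) mod p = j"
      using i j \<open>i \<noteq> j\<close> by (auto simp: d_def)
    define c where "c = a[i := k, j := Suc k]"
    have ac: "a \<rightarrow>\<^sup>*\<^bsub>config_graph p n\<^esub> c"
      using reachable_exchange[OF less.prems i(1) d(1,2) i(2)] j d(3) by (simp add: c_def)
    have "c \<in> configs p n"
      using reachable_in_verts[OF ac] by (simp add: config_graph_def)
    moreover have "set c \<subseteq> {k, Suc k}"
      using less.prems(2) unfolding c_def by (auto dest!: set_update_subset_insert[THEN subsetD])
    moreover have "card {x. x < p \<and> c ! x \<noteq> b ! x} < card {x. x < p \<and> a ! x \<noteq> b ! x}"
    proof (intro psubset_card_mono psubsetI)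
      have c: "c ! i = b ! i" "c ! j = b ! j" "\<And>x. x \<noteq> i \<Longrightarrow> x \<noteq> j \<Longrightarrow> c ! x = a ! x"
        using i j \<open>i \<noteq> j\<close> len by (simp_all add: c_def)
      show "{x. x < p \<and> c ! x \<noteq> b ! x} \<subseteq> {x. x < p \<and> a ! x \<noteq> b ! x}"
      proof
        fix x assume x: "x \<in> {x. x < p \<and> c ! x \<noteq> b ! x}"
        with c(1,2) have "x \<noteq> i" "x \<noteq> j"
          by blast+
        with x c(3)[of x] show "x \<in> {x. x < p \<and> a ! x \<noteq> b ! x}"
          by simp
      qed
      have "i \<in> {x. x < p \<and> a ! x \<noteq> b ! x}" "i \<notin> {x. x < p \<and> c ! x \<noteq> b ! x}"
        using i c(1) by auto
      then show "{x. x < p \<and> c ! x \<noteq> b ! x} \<noteq> {x. x < p \<and> a ! x \<noteq> b ! x}"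
        by blast
    qed simp
    ultimately have "c \<rightarrow>\<^sup>*\<^bsub>config_graph p n\<^esub> b"
      using less.hyps by blast
    with ac show ?thesis
      by (rule reachable_trans)
  qed
qed

theorem theorem2:
  fixes p n :: nat
  assumes "p \<ge> 1"
  shows "(\<forall>C \<in> pre_digraph.sccs (config_graph p n). \<forall>D \<in> pre_digraph.sccs (config_graph p n).
            card (verts C) > 1 \<longrightarrow> card (verts D) > 1 \<longrightarrow> C = D) \<and>
         (\<forall>C \<in> pre_digraph.sccs (config_graph p n).
            card (verts C) > 1 \<longrightarrow> verts C = dual_configs p n)"
proof -
  interpret digraph "config_graph p n" by (rule digraph_config_graph)
  have dual: "dual_configs p n = {a. a \<rightarrow>\<^sup>+\<^bsub>config_graph p n\<^esub> a}"
    unfolding dual_configs_def by (simp add: on_cycle_iff_reachable1)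
  have "u \<rightarrow>\<^sup>*\<^bsub>config_graph p n\<^esub> v"
    if "u \<rightarrow>\<^sup>+\<^bsub>config_graph p n\<^esub> u" "v \<rightarrow>\<^sup>+\<^bsub>config_graph p n\<^esub> v" for u v
  proof -
    have "u \<in> configs p n" "v \<in> configs p n"
      using that[THEN reachable1_in_verts(1)] by (auto simp: config_graph_def)
    \<comment> \<open>The level \<open>n div p\<close> depends only on \<open>n\<close> and
      \<open>p\<close>, so \<open>u\<close> and \<open>v\<close> share it.\<close>
    then show ?thesis
      using that[THEN balanced_if_reachable1_self] assms
      by (intro balanced_reachable[where k = "n div p"] balanced_values)
  qed
  then have *: "verts C = dual_configs p n" if "C \<in> sccs" "card (verts C) > 1" for C
    using that nontrivial_scc_eq[of "verts C"] unfolding dual sccs_verts_conv by blast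
  \<comment> \<open>Both components have vertex set \<open>dual_configs p n\<close>, and a component
    is determined by its vertices.\<close>
  then show ?thesis
    by (metis inj_on_verts_sccs inj_onD)
qed

end
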